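(* A unital basic pseudo hoop $(\mathbf A,u)$ belongs to $\mathcal{MNPH}$ (i.e. $\mathbf A\in\mathcal{MNPH}$) if, and only if, it satisfies the following system of inequalities: (i) $\big(\big(\prod_{i=1}^n x_i\big)\rightarrow u\big)^2\le \big(\prod_{i=1}^n x_{\pi(i)}^2\big)\rightarrow u$ for every $n\in\mathbb N$, every permutation $\pi$ of $\{1,\dots,n\}$ and all $x_1,\dots,x_n\in A$; (ii) $\big((x\rightarrow y)^n\rightarrow u\big)^2\le (x\rightsquigarrow y)^{2n}\rightarrow u$ for every $n\in\mathbb N$ and all $x,y\in A$; (iii) $\big((x\rightsquigarrow y)^n\rightarrow u\big)^2\le (x\rightarrow y)^{2n}\rightarrow u$ for every $n\in\mathbb N$ and all $x,y\in A$.
   Context: A pseudo hoop is an algebra $\mathbf A=(A;\cdot,\rightarrow,\rightsquigarrow,1)$ of type $\langle 2,2,2,0\rangle$ such that for all $x,y,z\in A$: $x\cdot 1=x=1\cdot x$; $x\rightarrow x=1=x\rightsquigarrow x$; $(x\cdot y)\rightarrow z=x\rightarrow(y\rightarrow z)$; $(x\cdot y)\rightsquigarrow z=y\rightsquigarrow(x\rightsquigarrow z)$; $(x\rightarrow y)\cdot x=(y\rightarrow x)\cdot y=x\cdot(x\rightsquigarrow y)=y\cdot(y\rightsquigarrow x)$. One sets $x\le y$ iff $x\rightarrow y=1$ (equivalently $x\rightsquigarrow y=1$); this is a partial order. A pseudo hoop is basic if for all $x,y,z\in A$: $(x\rightarrow y)\rightarrow z\le((y\rightarrow x)\rightarrow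 z)\rightarrow z$ and $(x\rightsquigarrow y)\rightsquigarrow z\le((y\rightsquigarrow x)\rightsquigarrow z)\rightsquigarrow z$. One writes $xy$ for $x\cdot y$; $\cdot$ binds more strongly than $\rightarrow,\rightsquigarrow$. Notation: $x^0:=1$, $x^1:=x$, $x^{n+1}:=x^n\cdot x$; $\prod_{i=1}^n x_i:=x_1x_2\cdots x_n$ (in this order); $\mathbb N=\{1,2,\dots\}$. A filter of $\mathbf A$ is a non-empty $F\subseteq A$ closed under $\cdot$ and upward closed. A filter is maximal if it is proper ($\neq A$) and is not properly contained in any proper filter. A filter $F$ is normal if for all $x,y\in A$: $x\rightarrow y\in F$ iff $x\rightsquigarrow y\in F$. An element $u\in A$ is a strong unit if the filter generated by $u$, $\{x\in A: x\ge u^n\text{ for some }n\ge1\}$, equals $A$. A unital (basic) pseudo hoop is a pair $(\mathbf A,u)$ with $\mathbf A$ a (basic) pseudo hoop and $u$ a fixed strong unit of $\mathbf A$. $\mathcal{MNPH}$ is the class of pseudo hoops $\mathbf A$ such that either every maximal filter of $\mathbf A$ is normal or $A=\{1\}$. *)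

theory Defs
  imports Main "HOL-Combinatorics.Permutations"
begin

class pseudo_hoop = times + one + ord +
  fixes left_imp :: "'a \<Rightarrow> 'a \<Rightarrow> 'a"  (infixr "\<^bold>\<rightarrow>" 60)
    and right_imp :: "'a \<Rightarrow> 'a \<Rightarrow> 'a"  (infixr "\<^bold>\<leadsto>" 60)
  assumes mult_one_right: "x * 1 = x"
    and mult_one_left: "1 * x = x"
    and left_imp_refl: "x \<^bold>\<rightarrow> x = 1"
    and right_imp_refl: "x \<^bold>\<leadsto> x = 1"
    and left_imp_mult: "(x * y) \<^bold>\<rightarrow> z = x \<^bold>\<rightarrow> (y \<^bold>\<rightarrow> z)"
    and right_imp_mult: "(x * y) \<^bold>\<leadsto> z = y \<^bold>\<leadsto> (x \<^bold>\<leadsto> z)"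
    and left_imp_div: "(x \<^bold>\<rightarrow> y) * x = (y \<^bold>\<rightarrow> x) * y"
    and left_right_div: "(y \<^bold>\<rightarrow> x) * y = x * (x \<^bold>\<leadsto> y)"
    and right_imp_div: "x * (x \<^bold>\<leadsto> y) = y * (y \<^bold>\<leadsto> x)"
    and le_iff_left_imp: "x \<le> y \<longleftrightarrow> x \<^bold>\<rightarrow> y = 1"
    and less_iff_le_not_le: "x < y \<longleftrightarrow> x \<le> y \<and> \<not> y \<le> x"
begin

lemma left_imp_antisym:
  assumes "x \<^bold>\<rightarrow> y = 1" "y \<^bold>\<rightarrow> x = 1"
  shows "x = y"
  using assms left_imp_div mult_one_left by metis

lemma mult_assoc_hoop: "(x * y) * z = x * (y * z)"
proof -
  have "((x * y) * z) \<^bold>\<rightarrow> w = (x * (y * z)) \<^bold>\<rightarrow> w" for w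
    by (simp add: left_imp_mult)
  then show ?thesis
    by (metis left_imp_antisym left_imp_refl)
qed

lemma one_left_imp: "1 \<^bold>\<rightarrow> x = x"
  by (rule left_imp_antisym)
    (metis left_imp_mult left_imp_refl mult_one_right mult_one_left)+

lemma left_imp_one: "x \<^bold>\<rightarrow> 1 = 1"
  by (metis one_left_imp left_imp_div left_imp_mult left_imp_refl)

lemma le_iff_right_imp: "x \<le> y \<longleftrightarrow> x \<^bold>\<leadsto> y = 1"
  unfolding le_iff_left_imp
  by (metis left_imp_mult left_imp_refl left_right_div mult_one_right
      right_imp_div right_imp_mult right_imp_refl)

lemma left_imp_trans:
  assumes "x \<^bold>\<rightarrow> y = 1" "y \<^bold>\<rightarrow> z = 1"
  shows "x \<^bold>\<rightarrow> z = 1"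
  using assms left_imp_one by (metis left_imp_mult left_imp_div mult_one_left)

end

text \<open>
  Associativity is a consequence of the axioms, so the library's powers and list products
  apply. The library reads \<open>x ^ Suc n\<close> as \<open>x * x ^ n\<close>; by associativity
  this agrees with \<open>x ^ n * x\<close>.
\<close>

subclass (in pseudo_hoop) monoid_mult
  by unfold_locales (fact mult_assoc_hoop mult_one_left mult_one_right)+

subclass (in pseudo_hoop) order
proof
  show "x < y \<longleftrightarrow> x \<le> y \<and> \<not> y \<le> x" for x y
    by (fact less_iff_le_not_le)
  show "x \<le> x" for x
    by (simp add: le_iff_left_imp left_imp_refl)
  show "x \<le> z" if "x \<le> y" "y \<le> z" for x y z
    using that left_imp_trans by (simp add: le_iff_left_imp)
  show "x = y" if "x \<le> y" "y \<le> x" for x y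
    using that left_imp_antisym by (simp add: le_iff_left_imp)
qed

class basic_pseudo_hoop = pseudo_hoop +
  assumes left_basic:
      "(x \<^bold>\<rightarrow> y) \<^bold>\<rightarrow> z \<le> ((y \<^bold>\<rightarrow> x) \<^bold>\<rightarrow> z) \<^bold>\<rightarrow> z"
    and right_basic:
      "(x \<^bold>\<leadsto> y) \<^bold>\<leadsto> z \<le> ((y \<^bold>\<leadsto> x) \<^bold>\<leadsto> z) \<^bold>\<leadsto> z"

context pseudo_hoop
begin

definition hoop_filter :: "'a set \<Rightarrow> bool" where
  "hoop_filter F \<longleftrightarrow> F \<noteq> {} \<and> (\<forall>x\<in>F. \<forall>y\<in>F. x * y \<in> F)
     \<and> (\<forall>x y. x \<in> F \<longrightarrow> x \<le> y \<longrightarrow> y \<in> F)"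

definition maximal_filter :: "'a set \<Rightarrow> bool" where
  "maximal_filter F \<longleftrightarrow> hoop_filter F \<and> F \<noteq> UNIV
     \<and> \<not> (\<exists>G. hoop_filter G \<and> G \<noteq> UNIV \<and> F \<subset> G)"

definition normal_filter :: "'a set \<Rightarrow> bool" where
  "normal_filter F \<longleftrightarrow> hoop_filter F \<and> (\<forall>x y. x \<^bold>\<rightarrow> y \<in> F \<longleftrightarrow> x \<^bold>\<leadsto> y \<in> F)"

definition generated_filter :: "'a \<Rightarrow> 'a set" where
  "generated_filter u = {x. \<exists>n\<ge>1. u ^ n \<le> x}"

definition strong_unit :: "'a \<Rightarrow> bool" where
  "strong_unit u \<longleftrightarrow> generated_filter u = UNIV"

end

text \<open>Membership of the algebra carried by the type \<open>'a\<close> in the class MNPH.\<close>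

definition in_MNPH :: "'a::pseudo_hoop itself \<Rightarrow> bool" where
  "in_MNPH _ \<longleftrightarrow> (\<forall>F :: 'a set. maximal_filter F \<longrightarrow> normal_filter F) \<or> (UNIV :: 'a set) = {1}"

text \<open>The ordered product \<open>x 1 * x 2 * \<dots> * x n\<close>; multiplication is not commutative.\<close>

definition ordered_prod :: "nat \<Rightarrow> (nat \<Rightarrow> 'a::monoid_mult) \<Rightarrow> 'a" where
  "ordered_prod n x = prod_list (map x [1..<Suc n])"

end

theory Submission
  imports Defs
begin

text \<open>
  Forward direction: if \<open>w \<le> u\<close> fails, some prime filter \<open>P\<close> omits \<open>w \<rightarrow> u\<close>, and \<open>P\<close> lies in a
  maximal filter \<open>M\<close>, which is normal by assumption. The quotient by \<open>M\<close> is a simple linearly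
  ordered hoop, hence commutative by a Hoelder-type argument. Each inequality can be split as
  \<open>s * v \<le> u\<close> such that \<open>v \<le> u\<close> and \<open>s < 1\<close> hold modulo \<open>M\<close>; as \<open>s < (v \<rightarrow> u)\<close> is then strict
  modulo \<open>M\<close>, it holds weakly modulo the prime filter \<open>P\<close>, a contradiction.

  Backward direction: if \<open>z \<notin> M\<close> for a maximal filter \<open>M\<close>, then \<open>(f * z) ^ k \<le> u\<close> for some
  \<open>f \<in> M\<close>. Inequality (i) sorts this to \<open>f ^ (2 * k) * z ^ (2 * k) \<le> u\<close>, whence \<open>z ^ (2 * k) \<rightarrow> u \<in> M\<close>.
  If \<open>z\<close> is one of the two residuals of \<open>x, y\<close>, then (ii) or (iii) shows that the other residual
  is not in \<open>M\<close> either, since otherwise \<open>u \<in> M\<close>.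
\<close>

section \<open>Residuation\<close>

context pseudo_hoop
begin

lemma le_left_imp_iff: "x \<le> y \<^bold>\<rightarrow> z \<longleftrightarrow> x * y \<le> z"
  by (simp add: le_iff_left_imp left_imp_mult)

lemma le_right_imp_iff: "y \<le> x \<^bold>\<leadsto> z \<longleftrightarrow> x * y \<le> z"
  by (simp add: le_iff_right_imp right_imp_mult)

lemma le_one: "x \<le> 1"
  by (simp add: le_iff_left_imp left_imp_one)

lemma one_le_iff: "1 \<le> x \<longleftrightarrow> x = 1"
  using le_one order.antisym by blast

lemma hoop_mult_mono:
  assumes "x \<le> x'" "y \<le> y'"
  shows "x * y \<le> x' * y'"
proof -
  have "x \<le> y \<^bold>\<rightarrow> x' * y"
    using assms(1) le_left_imp_iff order.refl order.trans by blast
  moreover have "y \<le> x' \<^bold>\<leadsto> x' * y'"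
    using assms(2) le_right_imp_iff order.refl order.trans by blast
  ultimately show ?thesis
    using le_left_imp_iff le_right_imp_iff order.trans by blast
qed

lemma mult_le_left: "x * y \<le> x"
  using hoop_mult_mono[OF order.refl le_one, of x y] by (simp add: mult_one_right)

lemma mult_le_right: "x * y \<le> y"
  using hoop_mult_mono[OF le_one order.refl, of x y] by (simp add: mult_one_left)

lemma left_imp_mult_le: "(x \<^bold>\<rightarrow> y) * x \<le> y"
  using le_left_imp_iff order.refl by blast

lemma mult_right_imp_le: "x * (x \<^bold>\<leadsto> y) \<le> y"
  using le_right_imp_iff order.refl by blast

lemma left_imp_compose_le: "(y \<^bold>\<rightarrow> z) * (x \<^bold>\<rightarrow> y) \<le> x \<^bold>\<rightarrow> z"
proof -
  have "(y \<^bold>\<rightarrow> z) * ((x \<^bold>\<rightarrow> y) * x) \<le> (y \<^bold>\<rightarrow> z) * y"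
    by (intro hoop_mult_mono order.refl left_imp_mult_le)
  then show ?thesis
    by (metis le_left_imp_iff left_imp_mult_le mult_assoc_hoop order.trans)
qed

lemma left_imp_le_mult_right: "x \<^bold>\<rightarrow> y \<le> x * z \<^bold>\<rightarrow> y * z"
  by (metis hoop_mult_mono le_left_imp_iff left_imp_mult_le mult_assoc_hoop order.refl)

lemma right_imp_le_mult_left: "x \<^bold>\<leadsto> y \<le> z * x \<^bold>\<leadsto> z * y"
  by (metis hoop_mult_mono le_right_imp_iff mult_right_imp_le mult_assoc_hoop order.refl)

end

lemma hoop_power_mono:
  fixes x y :: "'a::pseudo_hoop"
  assumes "x \<le> y"
  shows "x ^ n \<le> y ^ n"
  by (induction n) (auto intro: hoop_mult_mono assms)

lemma prod_list_square_le:
  fixes ys :: "'a::pseudo_hoop list"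
  shows "prod_list (map (\<lambda>y. y ^ 2) ys) \<le> prod_list ys"
  by (induction ys) (auto intro!: hoop_mult_mono simp: power2_eq_square mult_le_left)

text \<open>Under a common bound \<open>w\<close> both inner implications of
  \<open>left_basic\<close> become 1, leaving \<open>1 \<le> 1 \<rightarrow> w\<close>. So the two
  left residuals have join 1.\<close>

lemma basic_imp_join_eq_one:
  fixes w :: "'a::basic_pseudo_hoop"
  assumes "x \<^bold>\<rightarrow> y \<le> w" "y \<^bold>\<rightarrow> x \<le> w"
  shows "w = 1"
  using left_basic[of x y w] assms by (simp add: le_iff_left_imp one_left_imp)

section \<open>Filters\<close>

lemma hoop_filterI:
  assumes "1 \<in> F" "\<And>x y. x \<in> F \<Longrightarrow> y \<in> F \<Longrightarrow> x * y \<in> F" "\<And>x y. x \<in> F \<Longrightarrow> x \<le> y \<Longrightarrow> y \<in> F"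
  shows "hoop_filter F"
  using assms unfolding hoop_filter_def by blast

lemma hoop_filter_mult: "hoop_filter F \<Longrightarrow> x \<in> F \<Longrightarrow> y \<in> F \<Longrightarrow> x * y \<in> F"
  unfolding hoop_filter_def by blast

lemma hoop_filter_up: "hoop_filter F \<Longrightarrow> x \<in> F \<Longrightarrow> x \<le> y \<Longrightarrow> y \<in> F"
  unfolding hoop_filter_def by blast

lemma hoop_filter_one: "hoop_filter F \<Longrightarrow> 1 \<in> F"
  unfolding hoop_filter_def using le_one by blast

lemma hoop_filter_power: "hoop_filter F \<Longrightarrow> x \<in> F \<Longrightarrow> x ^ n \<in> F"
  by (induction n) (auto intro: hoop_filter_one hoop_filter_mult)

lemma hoop_filter_mp: "hoop_filter F \<Longrightarrow> x \<in> F \<Longrightarrow> x \<^bold>\<rightarrow> y \<in> F \<Longrightarrow> y \<in> F"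
  using hoop_filter_mult hoop_filter_up left_imp_mult_le by blast

lemma hoop_filter_strong_unit:
  assumes "strong_unit u" "hoop_filter F" "u \<in> F"
  shows "F = UNIV"
proof -
  have "x \<in> F" for x
    using assms hoop_filter_power hoop_filter_up
    unfolding strong_unit_def generated_filter_def by blast
  then show ?thesis by blast
qed

lemma hoop_filter_Union_chain:
  assumes "subset.chain {F. hoop_filter F} C" "C \<noteq> {}"
  shows "hoop_filter (\<Union>C)"
proof (rule hoop_filterI)
  have fil: "hoop_filter F" if "F \<in> C" for F
    using assms(1) that unfolding subset.chain_def by blast
  show "1 \<in> \<Union>C"
    using assms(2) fil hoop_filter_one by blast
  show "x * y \<in> \<Union>C" if xy: "x \<in> \<Union>C" "y \<in> \<Union>C" for x y
  proof -
    obtain F G where "F \<in> C" "x \<in> F" "G \<in> C" "y \<in> G"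
      using xy by blast
    moreover from this have "F \<subseteq> G \<or> G \<subseteq> F"
      using assms(1) unfolding subset_chain_def by blast
    ultimately show ?thesis
      using fil hoop_filter_mult by blast
  qed
  show "y \<in> \<Union>C" if "x \<in> \<Union>C" "x \<le> y" for x y
    using that fil hoop_filter_up by blast
qed

section \<open>Filters maximal among those omitting a given element\<close>

definition filter_value :: "'a::pseudo_hoop \<Rightarrow> 'a set \<Rightarrow> bool" where
  "filter_value t F \<longleftrightarrow> hoop_filter F \<and> t \<notin> F \<and> (\<forall>G. hoop_filter G \<longrightarrow> F \<subset> G \<longrightarrow> t \<in> G)"

lemma filter_value_exists:
  assumes "hoop_filter F" "t \<notin> F"
  obtains G where "F \<subseteq> G" "filter_value t G"
proof -
  let ?S = "{G. hoop_filter G \<and> F \<subseteq> G \<and> t \<notin> G}"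
  have "\<exists>M\<in>?S. \<forall>X\<in>?S. M \<subseteq> X \<longrightarrow> X = M"
  proof (rule subset_Zorn_nonempty)
    show "?S \<noteq> {}" using assms by blast
    fix C assume C: "C \<noteq> {}" "subset.chain ?S C"
    then have "subset.chain {F. hoop_filter F} C"
      unfolding subset.chain_def by blast
    with C(1) have "hoop_filter (\<Union>C)"
      by (intro hoop_filter_Union_chain)
    then show "\<Union>C \<in> ?S"
      using C unfolding subset.chain_def by blast
  qed
  then obtain M where M: "M \<in> ?S" and max: "\<forall>X\<in>?S. M \<subseteq> X \<longrightarrow> X = M"
    by (rule bexE)
  have "t \<in> G" if "hoop_filter G" "M \<subset> G" for G
  proof (rule ccontr)
    assume "t \<notin> G"
    with that M have "G \<in> ?S" by auto
    with max that(2) show False by (metis psubset_eq)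
  qed
  then have "filter_value t M"
    using M by (simp add: filter_value_def)
  then show thesis using that[of M] M by simp
qed

text \<open>A filter is proper exactly when it omits the strong unit; this makes
  \<open>prime_filter_value\<close> available for maximal filters.\<close>

lemma maximal_filter_iff_value:
  assumes "strong_unit u"
  shows "maximal_filter M \<longleftrightarrow> filter_value u M"
  using hoop_filter_strong_unit[OF assms] unfolding maximal_filter_def filter_value_def by blast

section \<open>Primeness of values in basic pseudo hoops\<close>

definition prime_filter :: "'a::pseudo_hoop set \<Rightarrow> bool" where
  "prime_filter F \<longleftrightarrow> hoop_filter F \<and> (\<forall>x y. x \<^bold>\<rightarrow> y \<in> F \<or> y \<^bold>\<rightarrow> x \<in> F)"

text \<open>The elements \<open>g\<close> with \<open>g \<squnion> x \<in> F\<close>, phrased without the join of the lattice order.\<close>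

definition join_residual :: "'a::pseudo_hoop set \<Rightarrow> 'a \<Rightarrow> 'a set" where
  "join_residual F x = {g. \<exists>r\<in>F. \<forall>w. g \<le> w \<longrightarrow> x \<le> w \<longrightarrow> r \<le> w}"

text \<open>For products, a bound \<open>w\<close> is residuated twice:
  \<open>g \<leadsto> w\<close> bounds \<open>h\<close> and \<open>x\<close>, hence
  \<open>s\<close>; then \<open>s \<rightarrow> w\<close> bounds \<open>g\<close> and
  \<open>x\<close>, hence \<open>r\<close>.\<close>

lemma hoop_filter_join_residual:
  assumes F: "hoop_filter F"
  shows "hoop_filter (join_residual F x)"
proof (rule hoop_filterI)
  show "1 \<in> join_residual F x"
    unfolding join_residual_def using hoop_filter_one[OF F] by blast
  show "h \<in> join_residual F x" if "g \<in> join_residual F x" "g \<le> h" for g h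
    using that order.trans unfolding join_residual_def by blast
  fix g h assume "g \<in> join_residual F x" "h \<in> join_residual F x"
  then obtain r s
    where r: "r \<in> F" "\<And>w. g \<le> w \<Longrightarrow> x \<le> w \<Longrightarrow> r \<le> w"
      and s: "s \<in> F" "\<And>w. h \<le> w \<Longrightarrow> x \<le> w \<Longrightarrow> s \<le> w"
    unfolding join_residual_def by blast
  have "r * s \<le> w" if w: "g * h \<le> w" "x \<le> w" for w
  proof -
    have "h \<le> g \<^bold>\<leadsto> w" "x \<le> g \<^bold>\<leadsto> w"
      using w(1) order.trans[OF mult_le_right w(2)] by (auto simp: le_right_imp_iff)
    then have "s \<le> g \<^bold>\<leadsto> w"
      by (rule s(2))
    then have "g \<le> s \<^bold>\<rightarrow> w" "x \<le> s \<^bold>\<rightarrow> w"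
      using order.trans[OF mult_le_left w(2)] by (auto simp: le_right_imp_iff le_left_imp_iff)
    then have "r \<le> s \<^bold>\<rightarrow> w"
      by (rule r(2))
    then show ?thesis by (simp add: le_left_imp_iff)
  qed
  then show "g * h \<in> join_residual F x"
    unfolding join_residual_def using hoop_filter_mult[OF F r(1) s(1)] by blast
qed

lemma subset_join_residual: "F \<subseteq> join_residual F x"
  unfolding join_residual_def by blast

lemma join_residual_sym: "g \<in> join_residual F x \<longleftrightarrow> x \<in> join_residual F g"
  unfolding join_residual_def by blast

text \<open>If neither residual lies in \<open>F\<close>, their join 1 puts one into the join
  residual of the other. Maximality of \<open>F\<close> lets \<open>t\<close> replace both in turn,
  so \<open>t\<close> lies above an element of \<open>F\<close>.\<close>

lemma prime_filter_value:
  fixes F :: "'a::basic_pseudo_hoop set"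
  assumes "filter_value t F"
  shows "prime_filter F"
proof -
  have F: "hoop_filter F" "t \<notin> F"
    using assms by (auto simp: filter_value_def)
  have step: "t \<in> join_residual F b" if "a \<in> join_residual F b" "a \<notin> F" for a b
    using assms that hoop_filter_join_residual[OF F(1), of b] subset_join_residual[of F b]
    unfolding filter_value_def by blast
  have False if p: "x \<^bold>\<rightarrow> y \<notin> F" and q: "y \<^bold>\<rightarrow> x \<notin> F" for x y
  proof -
    have "x \<^bold>\<rightarrow> y \<in> join_residual F (y \<^bold>\<rightarrow> x)"
      unfolding join_residual_def
      using basic_imp_join_eq_one[of x y] hoop_filter_one[OF F(1)] by blast
    then have "t \<in> join_residual F t"
      using step p q join_residual_sym by blast
    then show False
      using F hoop_filter_up unfolding join_residual_def by blast
  qed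
  then show ?thesis
    unfolding prime_filter_def using F(1) by blast
qed

section \<open>The preorder modulo a normal filter\<close>

text \<open>Stands in for the order of the quotient by \<open>M\<close>, which is never formed. For
  normal \<open>M\<close>, \<open>x \<notin> M\<close> says that the class of \<open>x\<close> is
  strictly below 1.\<close>

definition le_mod :: "'a::pseudo_hoop set \<Rightarrow> 'a \<Rightarrow> 'a \<Rightarrow> bool" where
  "le_mod M x y \<longleftrightarrow> x \<^bold>\<rightarrow> y \<in> M"

lemma le_mod_one_iff: "le_mod M 1 x \<longleftrightarrow> x \<in> M"
  by (simp add: le_mod_def one_left_imp)

locale normal_hoop_filter =
  fixes M :: "'a::pseudo_hoop set"
  assumes normal: "normal_filter M"
begin

lemma filter_M: "hoop_filter M"
  using normal by (simp add: normal_filter_def)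

lemma le_mod_iff_right: "le_mod M x y \<longleftrightarrow> x \<^bold>\<leadsto> y \<in> M"
  using normal by (simp add: normal_filter_def le_mod_def)

lemma le_modI: "x \<le> y \<Longrightarrow> le_mod M x y"
  using hoop_filter_one[OF filter_M] by (simp add: le_mod_def le_iff_left_imp)

lemma le_mod_refl: "le_mod M x x"
  by (simp add: le_modI)

lemma le_mod_trans [trans]: "le_mod M x y \<Longrightarrow> le_mod M y z \<Longrightarrow> le_mod M x z"
  unfolding le_mod_def
  using hoop_filter_mult[OF filter_M] hoop_filter_up[OF filter_M] left_imp_compose_le by blast

lemma le_mod_mult_right: "le_mod M x y \<Longrightarrow> le_mod M (x * z) (y * z)"
  unfolding le_mod_def using hoop_filter_up[OF filter_M] left_imp_le_mult_right by blast

text \<open>Normality enters here: left multiplication is controlled by the right residual.\<close>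

lemma le_mod_mult_left: "le_mod M x y \<Longrightarrow> le_mod M (z * x) (z * y)"
  unfolding le_mod_iff_right using hoop_filter_up[OF filter_M] right_imp_le_mult_left by blast

lemma le_mod_mult: "le_mod M x y \<Longrightarrow> le_mod M x' y' \<Longrightarrow> le_mod M (x * x') (y * y')"
  using le_mod_mult_left le_mod_mult_right le_mod_trans by blast

lemma le_mod_power: "le_mod M x y \<Longrightarrow> le_mod M (x ^ n) (y ^ n)"
  by (induction n) (auto intro: le_mod_mult le_mod_refl)

lemma le_mod_left_imp_iff: "le_mod M x (y \<^bold>\<rightarrow> z) \<longleftrightarrow> le_mod M (x * y) z"
  by (simp add: le_mod_def left_imp_mult)

lemma le_mod_right_imp_iff: "le_mod M y (x \<^bold>\<leadsto> z) \<longleftrightarrow> le_mod M (x * y) z"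
  by (simp add: le_mod_iff_right right_imp_mult)

text \<open>The elements above some power of \<open>e\<close> modulo \<open>M\<close> form a filter
  that properly extends \<open>M\<close>.\<close>

lemma archimedean_mod:
  assumes max: "maximal_filter M" and e: "e \<notin> M"
  shows "\<exists>n. le_mod M (e ^ n) x"
proof -
  let ?G = "{g. \<exists>n. le_mod M (e ^ n) g}"
  have "hoop_filter ?G"
  proof (rule hoop_filterI)
    show "1 \<in> ?G"
      using le_modI le_one by blast
    show "g * h \<in> ?G" if gh: "g \<in> ?G" "h \<in> ?G" for g h
    proof -
      obtain m n where "le_mod M (e ^ m) g" "le_mod M (e ^ n) h"
        using gh by blast
      then have "le_mod M (e ^ (m + n)) (g * h)"
        by (simp add: power_add le_mod_mult)
      then show ?thesis by blast
    qed
    show "h \<in> ?G" if "g \<in> ?G" "g \<le> h" for g h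
      using that le_modI le_mod_trans by blast
  qed
  moreover have "M \<subseteq> ?G"
  proof
    fix g assume "g \<in> M"
    then have "le_mod M (e ^ 0) g" by (simp add: le_mod_one_iff)
    then show "g \<in> ?G" by blast
  qed
  moreover have "e \<in> ?G"
    using le_mod_refl[of e] by (auto intro: exI[of _ 1])
  ultimately have "?G = UNIV"
    using max e unfolding maximal_filter_def by blast
  then show ?thesis by blast
qed

end

section \<open>Simple quotients are commutative\<close>

locale simple_hoop_filter = normal_hoop_filter +
  assumes maximal: "maximal_filter M"
    and prime: "prime_filter M"
begin

lemma le_mod_total: "le_mod M x y \<or> le_mod M y x"
  using prime by (simp add: prime_filter_def le_mod_def)

text \<open>By divisibility the right side equals \<open>x * (x \<leadsto> y)\<close>, whose second
  factor is 1 modulo \<open>M\<close>.\<close>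

lemma le_mod_mult_right_imp:
  assumes "le_mod M x y"
  shows "le_mod M x (y * (y \<^bold>\<leadsto> x))"
proof -
  have "le_mod M (x * 1) (x * (x \<^bold>\<leadsto> y))"
    using assms by (intro le_mod_mult_left) (simp add: le_mod_one_iff flip: le_mod_iff_right)
  then show ?thesis
    by (simp add: right_imp_div)
qed

lemma power_bracket:
  assumes "e \<notin> M"
  obtains m where "le_mod M (e ^ Suc m) x" "le_mod M x (e ^ m)"
proof (cases "le_mod M (e ^ 0) x")
  case True
  have "le_mod M (e ^ Suc 0) (e ^ 0)" "le_mod M x (e ^ 0)"
    by (simp_all add: le_modI le_one)
  then show thesis
    using that True le_mod_trans by blast
next
  case False
  obtain n where "le_mod M (e ^ n) x"
    using archimedean_mod[OF maximal assms] by blast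
  then obtain m where "\<not> le_mod M (e ^ m) x" "le_mod M (e ^ Suc m) x"
    using ex_least_nat_less[of "\<lambda>k. le_mod M (e ^ k) x" n] False by blast
  then show thesis
    using that le_mod_total by blast
qed

text \<open>With \<open>x\<close> and \<open>y\<close> between consecutive powers of
  \<open>e\<close>, \<open>x * y\<close> is at most \<open>e ^ (m + n)\<close> and
  \<open>y * x\<close> at least \<open>e ^ (m + n + 2)\<close> modulo \<open>M\<close>.\<close>

lemma commutator_ge_square:
  assumes "e \<notin> M"
  shows "le_mod M (e ^ 2) (x * y \<^bold>\<rightarrow> y * x)"
proof -
  obtain m where m: "le_mod M (e ^ Suc m) x" "le_mod M x (e ^ m)"
    using power_bracket[OF assms] .
  obtain n where n: "le_mod M (e ^ Suc n) y" "le_mod M y (e ^ n)"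
    using power_bracket[OF assms] .
  have "le_mod M (e ^ 2 * (x * y)) (e ^ 2 * (e ^ m * e ^ n))"
    by (intro le_mod_mult_left le_mod_mult m n)
  also have "e ^ 2 * (e ^ m * e ^ n) = e ^ Suc n * e ^ Suc m"
    by (simp only: flip: power_add) (simp add: add.commute)
  also have "le_mod M (e ^ Suc n * e ^ Suc m) (y * x)"
    by (intro le_mod_mult m n)
  finally show ?thesis
    by (simp add: le_mod_left_imp_iff)
qed

text \<open>If \<open>x\<close> is strictly under \<open>h ^ m\<close>, then
  \<open>h ^ m \<leadsto> x\<close> is below 1, hence at most \<open>h\<close>, which pushes
  \<open>x\<close> down to \<open>h ^ Suc m\<close>.\<close>

lemma power_of_coatom:
  assumes h: "h \<notin> M" and coatom: "\<And>d. d \<notin> M \<Longrightarrow> le_mod M d h"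
  obtains m where "le_mod M (h ^ m) x" "le_mod M x (h ^ m)"
proof -
  obtain m where m: "le_mod M (h ^ Suc m) x" "le_mod M x (h ^ m)"
    using power_bracket[OF h] .
  show thesis
  proof (cases "h ^ m \<^bold>\<leadsto> x \<in> M")
    case True
    then show thesis
      using that m(2) le_mod_iff_right by blast
  next
    case False
    have "le_mod M x (h ^ m * (h ^ m \<^bold>\<leadsto> x))"
      by (intro le_mod_mult_right_imp m)
    also have "le_mod M (h ^ m * (h ^ m \<^bold>\<leadsto> x)) (h ^ m * h)"
      by (intro le_mod_mult_left coatom False)
    finally have "le_mod M x (h ^ Suc m)"
      by (simp only: power_Suc2)
    with m(1) show thesis by (rule that)
  qed
qed

text \<open>Without a coatom some \<open>b\<close> lies strictly between \<open>d\<close> and 1.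
  Both factors of \<open>b * (b \<leadsto> d)\<close> are then below 1, and the larger one serves as
  \<open>e\<close>.\<close>

lemma le_mod_square_exists:
  assumes dense: "\<And>h. h \<notin> M \<Longrightarrow> \<exists>d. d \<notin> M \<and> \<not> le_mod M d h" and d: "d \<notin> M"
  obtains e where "e \<notin> M" "le_mod M d (e ^ 2)"
proof -
  obtain b where b: "b \<notin> M" "\<not> le_mod M b d"
    using dense[OF d] by blast
  let ?c = "b \<^bold>\<leadsto> d"
  have c: "?c \<notin> M"
    using b(2) by (simp add: le_mod_iff_right)
  have "le_mod M d (b * ?c)"
    using b(2) le_mod_total by (blast intro: le_mod_mult_right_imp)
  moreover consider "le_mod M b ?c" | "le_mod M ?c b"
    using le_mod_total by blast
  ultimately show thesis
    using that b(1) c le_mod_mult_left le_mod_mult_right le_mod_trans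
    unfolding power2_eq_square by metis
qed

text \<open>
  If the quotient has a coatom, then all its elements are powers of it. Otherwise squares of
  elements below 1 get arbitrarily close to 1, while \<open>x * y \<rightarrow> y * x\<close> lies above all of them.
\<close>

lemma le_mod_commute: "le_mod M (x * y) (y * x)"
proof (cases "\<exists>h. h \<notin> M \<and> (\<forall>d. d \<notin> M \<longrightarrow> le_mod M d h)")
  case True
  then obtain h where h: "h \<notin> M" "\<And>d. d \<notin> M \<Longrightarrow> le_mod M d h" by blast
  obtain m where m: "le_mod M (h ^ m) x" "le_mod M x (h ^ m)"
    using power_of_coatom[OF h] .
  obtain n where n: "le_mod M (h ^ n) y" "le_mod M y (h ^ n)"
    using power_of_coatom[OF h] .
  have "le_mod M (x * y) (h ^ m * h ^ n)"
    by (intro le_mod_mult m n)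
  also have "h ^ m * h ^ n = h ^ n * h ^ m"
    by (simp add: add.commute flip: power_add)
  also have "le_mod M (h ^ n * h ^ m) (y * x)"
    by (intro le_mod_mult m n)
  finally show ?thesis .
next
  case False
  let ?c = "x * y \<^bold>\<rightarrow> y * x"
  show ?thesis
  proof (rule ccontr)
    assume "\<not> ?thesis"
    then have "?c \<notin> M" by (simp add: le_mod_def)
    then obtain d where d: "d \<notin> M" "\<not> le_mod M d ?c"
      using False by blast
    obtain e where "e \<notin> M" "le_mod M d (e ^ 2)"
      using le_mod_square_exists[OF _ d(1)] False by blast
    then show False
      using d(2) commutator_ge_square le_mod_trans by blast
  qed
qed

text \<open>The residuals coincide in the commutative quotient; this direction feeds (ii), the
  converse (iii).\<close>

lemma le_mod_right_imp_left_imp: "le_mod M (x \<^bold>\<leadsto> y) (x \<^bold>\<rightarrow> y)"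
  unfolding le_mod_left_imp_iff
  using le_mod_commute le_mod_trans le_modI mult_right_imp_le by blast

lemma le_mod_left_imp_right_imp: "le_mod M (x \<^bold>\<rightarrow> y) (x \<^bold>\<leadsto> y)"
  unfolding le_mod_right_imp_iff
  using le_mod_commute le_mod_trans le_modI left_imp_mult_le by blast

lemma le_mod_prod_list_perm:
  assumes "mset xs = mset ys"
  shows "le_mod M (prod_list xs) (prod_list ys)"
  using assms
proof (induction xs arbitrary: ys)
  case Nil
  then show ?case by (simp add: le_mod_refl)
next
  case (Cons x xs)
  from Cons.prems have "x \<in> set ys"
    by (metis list.set_intros(1) set_mset_mset)
  then obtain as bs where ys: "ys = as @ x # bs"
    by (meson split_list)
  with Cons.prems have "mset xs = mset (as @ bs)" by simp
  then have "le_mod M (x * prod_list xs) (x * (prod_list as * prod_list bs))"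
    using Cons.IH[of "as @ bs"] by (auto intro: le_mod_mult_left)
  also have "le_mod M (x * (prod_list as * prod_list bs)) (prod_list as * x * prod_list bs)"
    using le_mod_mult_right[OF le_mod_commute] by (simp add: mult.assoc)
  finally show ?case
    by (simp add: ys mult.assoc)
qed

end

section \<open>Lifting to a prime filter below a maximal one\<close>

locale prime_below_simple = simple_hoop_filter M for M :: "'a::pseudo_hoop set" +
  fixes P :: "'a set"
  assumes prime_P: "prime_filter P" and P_le_M: "P \<subseteq> M"
begin

text \<open>Since \<open>v \<rightarrow> u\<close> is in \<open>M\<close> and \<open>s\<close> is
  not, \<open>(v \<rightarrow> u) \<rightarrow> s\<close> is outside \<open>M\<close>, hence outside
  \<open>P\<close>. Primeness of \<open>P\<close> gives the opposite residual.\<close>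

lemma mult_imp_mem:
  assumes "s \<notin> M" "le_mod M v u"
  shows "s * v \<^bold>\<rightarrow> u \<in> P"
proof -
  have "(v \<^bold>\<rightarrow> u) \<^bold>\<rightarrow> s \<notin> M"
    using assms hoop_filter_mp[OF filter_M] unfolding le_mod_def by blast
  then show ?thesis
    using prime_P P_le_M by (auto simp: prime_filter_def left_imp_mult)
qed

lemma imp_mem_antimono:
  assumes "v \<le> w" "w \<^bold>\<rightarrow> u \<in> P"
  shows "v \<^bold>\<rightarrow> u \<in> P"
proof -
  have "(w \<^bold>\<rightarrow> u) * v \<le> u"
    using hoop_mult_mono[OF order.refl assms(1)] left_imp_mult_le order.trans by blast
  then show ?thesis
    using assms(2) prime_P hoop_filter_up unfolding prime_filter_def
    by (metis le_left_imp_iff)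
qed

text \<open>Factors in \<open>M\<close> are dropped from the front. At the first
  \<open>y \<notin> M\<close>, one copy of \<open>y\<close> is the strict factor \<open>s\<close> of
  \<open>mult_imp_mem\<close>; the other keeps the remaining product below \<open>u\<close> modulo
  \<open>M\<close>.\<close>

lemma prod_square_imp_mem:
  assumes u: "u \<notin> M" and ys: "le_mod M (prod_list ys) u"
  shows "prod_list (map (\<lambda>y. y ^ 2) ys) \<^bold>\<rightarrow> u \<in> P"
  using ys
proof (induction ys)
  case Nil
  then show ?case using u by (simp add: le_mod_one_iff)
next
  case (Cons y ys)
  let ?q = "prod_list (map (\<lambda>y. y ^ 2) ys)"
  show ?case
  proof (cases "y \<in> M")
    case True
    then have "le_mod M (1 * prod_list ys) (y * prod_list ys)"
      by (intro le_mod_mult_right) (simp add: le_mod_one_iff)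
    then have "?q \<^bold>\<rightarrow> u \<in> P"
      using Cons le_mod_trans by simp
    then show ?thesis
      using imp_mem_antimono[OF mult_le_right] by simp
  next
    case False
    have "le_mod M (y * ?q) (y * prod_list ys)"
      by (intro le_modI hoop_mult_mono order.refl prod_list_square_le)
    then have "y * (y * ?q) \<^bold>\<rightarrow> u \<in> P"
      using Cons.prems le_mod_trans by (intro mult_imp_mem False) auto
    then show ?thesis
      by (simp add: power2_eq_square mult.assoc)
  qed
qed

text \<open>If \<open>b \<rightarrow> u\<close> is outside \<open>M\<close>, one copy of it is the
  strict factor and the other takes \<open>b\<close> below \<open>u\<close>. Otherwise the product
  of \<open>ys\<close> is itself below \<open>u\<close> modulo \<open>M\<close>.\<close>

lemma square_imp_prod_square_mem:
  assumes u: "u \<notin> M" and ys: "le_mod M (prod_list ys) b"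
  shows "(b \<^bold>\<rightarrow> u) ^ 2 * prod_list (map (\<lambda>y. y ^ 2) ys) \<^bold>\<rightarrow> u \<in> P"
proof (cases "b \<^bold>\<rightarrow> u \<in> M")
  case True
  then have "le_mod M (prod_list ys) u"
    using ys le_mod_trans by (auto simp: le_mod_def[of M b u])
  then show ?thesis
    using prod_square_imp_mem[OF u] imp_mem_antimono mult_le_right by blast
next
  case False
  have "le_mod M ((b \<^bold>\<rightarrow> u) * prod_list (map (\<lambda>y. y ^ 2) ys)) ((b \<^bold>\<rightarrow> u) * b)"
    using ys le_modI[OF prod_list_square_le] by (blast intro: le_mod_mult_left le_mod_trans)
  also have "le_mod M ((b \<^bold>\<rightarrow> u) * b) u"
    by (intro le_modI left_imp_mult_le)
  finally show ?thesis
    using mult_imp_mem[OF False] by (simp add: power2_eq_square mult.assoc)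
qed

end

text \<open>Common source of (i), (ii) and (iii): each instance only has to verify
  \<open>le\<close>, a comparison in simple quotients.\<close>

lemma MNPH_square_imp_le:
  fixes u :: "'a::basic_pseudo_hoop"
  assumes u: "strong_unit u" and normal: "\<And>F :: 'a set. maximal_filter F \<Longrightarrow> normal_filter F"
    and le: "\<And>M. simple_hoop_filter M \<Longrightarrow> le_mod M (prod_list ys) b"
  shows "(b \<^bold>\<rightarrow> u) ^ 2 \<le> prod_list (map (\<lambda>y. y ^ 2) ys) \<^bold>\<rightarrow> u"
proof (rule ccontr)
  let ?t = "(b \<^bold>\<rightarrow> u) ^ 2 * prod_list (map (\<lambda>y. y ^ 2) ys) \<^bold>\<rightarrow> u"
  assume "\<not> ?thesis"
  then have "?t \<notin> {1}"
    by (simp add: le_iff_left_imp left_imp_mult)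
  moreover have "hoop_filter {1 :: 'a}"
    by (rule hoop_filterI) (auto simp: one_le_iff)
  ultimately obtain P where P: "filter_value ?t P"
    using filter_value_exists by blast
  then have "hoop_filter P" "u \<notin> P"
    using hoop_filter_strong_unit[OF u] unfolding filter_value_def by blast+
  then obtain M where M: "P \<subseteq> M" "filter_value u M"
    using filter_value_exists by blast
  then have "maximal_filter M"
    using maximal_filter_iff_value[OF u] by blast
  with M have simple: "simple_hoop_filter M"
    by (auto intro!: simple_hoop_filter.intro normal_hoop_filter.intro
        simple_hoop_filter_axioms.intro normal prime_filter_value)
  then interpret prime_below_simple M P
    using M P by (auto intro!: prime_below_simple.intro prime_below_simple_axioms.intro
        prime_filter_value)
  have "?t \<in> P"
    using M(2) le[OF simple] by (intro square_imp_prod_square_mem) (auto simp: filter_value_def)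
  then show False
    using P by (simp add: filter_value_def)
qed

section \<open>Normality of maximal filters from the inequalities\<close>

lemma ordered_prod_perm_imp_list:
  fixes u :: "'a::pseudo_hoop"
  assumes ineq: "\<And>n \<pi> (x :: nat \<Rightarrow> 'a). n \<ge> 1 \<Longrightarrow> \<pi> permutes {1..n} \<Longrightarrow>
      (ordered_prod n x \<^bold>\<rightarrow> u) ^ 2 \<le> ordered_prod n (\<lambda>i. (x (\<pi> i)) ^ 2) \<^bold>\<rightarrow> u"
    and xs: "mset xs = mset ys" "xs \<noteq> []"
  shows "(prod_list xs \<^bold>\<rightarrow> u) ^ 2 \<le> prod_list (map (\<lambda>y. y ^ 2) ys) \<^bold>\<rightarrow> u"
proof -
  let ?n = "length xs"
  obtain p where p: "p permutes {..<?n}" "permute_list p xs = ys"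
    using xs(1) mset_eq_permutation[of ys xs] by auto
  \<comment> \<open>Lists are indexed from 0 and \<open>ordered_prod\<close> from 1, so
    \<open>p\<close> is shifted by one; 0 lies outside \<open>{1..?n}\<close> and stays
    fixed.\<close>
  define \<pi> where "\<pi> i = (case i of 0 \<Rightarrow> 0 | Suc j \<Rightarrow> Suc (p j))" for i
  have "\<pi> permutes {1..?n}"
  proof (rule bij_imp_permutes)
    have pred: "bij_betw (\<lambda>i. i - 1) {1..?n} {..<?n}"
      by (rule bij_betw_byWitness[of _ Suc]) auto
    have succ: "bij_betw Suc {..<?n} {1..?n}"
      by (rule bij_betw_byWitness[of _ "\<lambda>i. i - 1"]) auto
    have "bij_betw (Suc \<circ> (p \<circ> (\<lambda>i. i - 1))) {1..?n} {1..?n}"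
      by (rule bij_betw_trans[OF bij_betw_trans[OF pred permutes_imp_bij[OF p(1)]] succ])
    moreover have "\<pi> i = (Suc \<circ> (p \<circ> (\<lambda>i. i - 1))) i" if "i \<in> {1..?n}" for i
      using that by (auto simp: \<pi>_def split: nat.split)
    ultimately show "bij_betw \<pi> {1..?n} {1..?n}"
      using bij_betw_cong[of "{1..?n}" \<pi>] by blast
    show "\<pi> i = i" if "i \<notin> {1..?n}" for i
      using that permutes_not_in[OF p(1)] by (auto simp: \<pi>_def split: nat.split)
  qed
  moreover have "?n \<ge> 1"
    using xs(2) by (simp add: Suc_leI)
  moreover have "ordered_prod ?n (\<lambda>i. xs ! (i - 1)) = prod_list xs"
    unfolding ordered_prod_def
    by (intro arg_cong[of _ _ prod_list] nth_equalityI) (auto simp del: upt_Suc)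
  moreover have "ordered_prod ?n (\<lambda>i. (xs ! (\<pi> i - 1)) ^ 2) = prod_list (map (\<lambda>y. y ^ 2) ys)"
    unfolding ordered_prod_def p(2)[symmetric]
    by (intro arg_cong[of _ _ prod_list] nth_equalityI)
      (auto simp: \<pi>_def permute_list_nth[OF p(1)] simp del: upt_Suc)
  ultimately show ?thesis
    using ineq[of ?n \<pi> "\<lambda>i. xs ! (i - 1)"] by simp
qed

text \<open>This is the filter generated by \<open>M\<close> and \<open>z\<close>. As
  \<open>M\<close> need not be normal, its elements cannot be moved past \<open>z\<close>, hence the
  alternating words; \<open>a * b\<close> is a common \<open>f\<close> for two of them.\<close>

lemma hoop_filter_adjoin:
  assumes M: "hoop_filter M"
  shows "hoop_filter {g. \<exists>f\<in>M. \<exists>k. (f * z) ^ k \<le> g}" (is "hoop_filter ?G")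
proof (rule hoop_filterI)
  show "1 \<in> ?G"
    using hoop_filter_one[OF M] le_one by blast
  show "g * h \<in> ?G" if gh: "g \<in> ?G" "h \<in> ?G" for g h
  proof -
    obtain a b k l where a: "a \<in> M" "(a * z) ^ k \<le> g" and b: "b \<in> M" "(b * z) ^ l \<le> h"
      using gh by blast
    have "(a * b * z) ^ k \<le> (a * z) ^ k" "(a * b * z) ^ l \<le> (b * z) ^ l"
      by (intro hoop_power_mono hoop_mult_mono order.refl mult_le_left mult_le_right)+
    then have "(a * b * z) ^ (k + l) \<le> g * h"
      using a b by (auto simp: power_add intro!: hoop_mult_mono elim: order.trans)
    then show ?thesis
      using hoop_filter_mult[OF M a(1) b(1)] by blast
  qed
  show "h \<in> ?G" if "g \<in> ?G" "g \<le> h" for g h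
    using that order.trans by blast
qed

lemma maximal_filter_power_imp_mem:
  fixes u :: "'a::pseudo_hoop"
  assumes max: "maximal_filter M" and z: "z \<notin> M"
    and perm: "\<And>xs ys. mset xs = mset ys \<Longrightarrow> xs \<noteq> [] \<Longrightarrow>
      (prod_list xs \<^bold>\<rightarrow> u) ^ 2 \<le> prod_list (map (\<lambda>y. y ^ 2) ys) \<^bold>\<rightarrow> u"
  obtains n where "n \<ge> 1" "z ^ n \<^bold>\<rightarrow> u \<in> M"
proof -
  have M: "hoop_filter M"
    using max by (simp add: maximal_filter_def)
  let ?G = "{g. \<exists>f\<in>M. \<exists>k. (f * z) ^ k \<le> g}"
  have "M \<subseteq> ?G"
  proof
    fix g assume "g \<in> M"
    moreover have "(g * z) ^ 1 \<le> g"
      by (simp add: mult_le_left)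
    ultimately show "g \<in> ?G" by blast
  qed
  moreover have "z \<in> ?G"
  proof -
    have "(1 * z) ^ 1 \<le> z" by simp
    then show ?thesis
      using hoop_filter_one[OF M] by blast
  qed
  ultimately have "?G = UNIV"
    using max z hoop_filter_adjoin[OF M, of z] unfolding maximal_filter_def by blast
  then obtain f k where f: "f \<in> M" "(f * z) ^ k \<le> u" by blast
  \<comment> \<open>\<open>k\<close> may be 0, but \<open>perm\<close> wants a non-empty list; an
    extra factor only lowers the product.\<close>
  let ?k = "Suc k"
  let ?xs = "concat (replicate ?k [f, z])"
  let ?ys = "replicate ?k f @ replicate ?k z"
  have "prod_list (concat (replicate m [f, z])) = (f * z) ^ m" for m
    by (induction m) (auto simp: mult.assoc)
  then have "prod_list ?xs \<le> u"
    using f(2) mult_le_right order.trans by (metis power_Suc)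
  then have "prod_list ?xs \<^bold>\<rightarrow> u = 1"
    by (simp add: le_iff_left_imp)
  moreover have "mset (concat (replicate m [f, z])) = mset (replicate m f @ replicate m z)" for m
    by (induction m) auto
  then have "(prod_list ?xs \<^bold>\<rightarrow> u) ^ 2 \<le> prod_list (map (\<lambda>y. y ^ 2) ?ys) \<^bold>\<rightarrow> u"
    by (rule perm) simp
  ultimately have "1 \<le> prod_list (map (\<lambda>y. y ^ 2) ?ys) \<^bold>\<rightarrow> u"
    by (simp only: power_one)
  then have "f ^ (2 * ?k) * z ^ (2 * ?k) \<le> u"
    unfolding power_mult by (simp add: le_left_imp_iff del: power_Suc replicate_Suc)
  then have "z ^ (2 * ?k) \<^bold>\<rightarrow> u \<in> M"
    using hoop_filter_power[OF M f(1)] hoop_filter_up[OF M] le_left_imp_iff by blast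
  then show thesis
    using that[of "2 * ?k"] by simp
qed

text \<open>With \<open>z\<close> and \<open>g\<close> the two residuals of one pair,
  \<open>ineq\<close> is (ii) or (iii); the two choices give the two directions of
  normality.\<close>

lemma maximal_filter_transfer_mem:
  fixes u :: "'a::pseudo_hoop"
  assumes u: "strong_unit u" and max: "maximal_filter M"
    and perm: "\<And>xs ys. mset xs = mset ys \<Longrightarrow> xs \<noteq> [] \<Longrightarrow>
      (prod_list xs \<^bold>\<rightarrow> u) ^ 2 \<le> prod_list (map (\<lambda>y. y ^ 2) ys) \<^bold>\<rightarrow> u"
    and ineq: "\<And>n. n \<ge> 1 \<Longrightarrow> (z ^ n \<^bold>\<rightarrow> u) ^ 2 \<le> g ^ (2 * n) \<^bold>\<rightarrow> u"
    and g: "g \<in> M"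
  shows "z \<in> M"
proof (rule ccontr)
  have M: "hoop_filter M" "M \<noteq> UNIV"
    using max by (auto simp: maximal_filter_def)
  assume "z \<notin> M"
  then obtain n where n: "n \<ge> 1" "z ^ n \<^bold>\<rightarrow> u \<in> M"
    using maximal_filter_power_imp_mem[OF max _ perm] by blast
  then have "g ^ (2 * n) \<^bold>\<rightarrow> u \<in> M"
    using ineq hoop_filter_power[OF M(1)] hoop_filter_up[OF M(1)] by blast
  then have "u \<in> M"
    using g hoop_filter_power[OF M(1)] hoop_filter_mp[OF M(1)] by blast
  then show False
    using M hoop_filter_strong_unit[OF u] by blast
qed

lemma prod_list_replicate_square:
  "prod_list (map (\<lambda>y. y ^ 2) (replicate n x)) = (x :: 'a::monoid_mult) ^ (2 * n)"
  by (simp add: power_mult)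

lemma in_MNPH_iff:
  "in_MNPH TYPE('a::pseudo_hoop) \<longleftrightarrow> (\<forall>F :: 'a set. maximal_filter F \<longrightarrow> normal_filter F)"
proof -
  have "\<not> maximal_filter F" if "(UNIV :: 'a set) = {1}" for F :: "'a set"
  proof
    assume F: "maximal_filter F"
    then have "{1} \<subseteq> F"
      using hoop_filter_one[of F] by (simp add: maximal_filter_def)
    then have "F = UNIV"
      using that by auto
    with F show False
      by (simp add: maximal_filter_def)
  qed
  then show ?thesis
    by (auto simp: in_MNPH_def)
qed

theorem theorem4p5:
  fixes u :: "'a::basic_pseudo_hoop"
  assumes "strong_unit u"
  shows "in_MNPH TYPE('a) \<longleftrightarrow>
    (\<forall>n\<ge>1. \<forall>\<pi>. \<pi> permutes {1..n} \<longrightarrow> (\<forall>x :: nat \<Rightarrow> 'a.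
        (ordered_prod n x \<^bold>\<rightarrow> u) ^ 2 \<le> ordered_prod n (\<lambda>i. (x (\<pi> i)) ^ 2) \<^bold>\<rightarrow> u)) \<and>
    (\<forall>n\<ge>1. \<forall>x y :: 'a.
        ((x \<^bold>\<rightarrow> y) ^ n \<^bold>\<rightarrow> u) ^ 2 \<le> (x \<^bold>\<leadsto> y) ^ (2 * n) \<^bold>\<rightarrow> u) \<and>
    (\<forall>n\<ge>1. \<forall>x y :: 'a.
        ((x \<^bold>\<leadsto> y) ^ n \<^bold>\<rightarrow> u) ^ 2 \<le> (x \<^bold>\<rightarrow> y) ^ (2 * n) \<^bold>\<rightarrow> u)"
    (is "_ \<longleftrightarrow> ?i \<and> ?ii \<and> ?iii")
proof
  assume "in_MNPH TYPE('a)"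
  then have normal: "\<And>F :: 'a set. maximal_filter F \<Longrightarrow> normal_filter F"
    by (simp add: in_MNPH_iff)
  note le = MNPH_square_imp_le[OF assms normal]
  have ?i
  proof (intro allI impI)
    fix n :: nat and \<pi> and x :: "nat \<Rightarrow> 'a"
    assume \<pi>: "\<pi> permutes {1..n}"
    let ?ys = "map (\<lambda>i. x (\<pi> i)) [1..<Suc n]"
    have "mset (map \<pi> [1..<Suc n]) = mset [1..<Suc n]"
      using permutes_image[OF \<pi>] permutes_inj_on[OF \<pi>]
      by (metis atLeastLessThanSuc_atLeastAtMost image_mset_mset_set mset_map mset_upt)
    then have "mset ?ys = mset (map x [1..<Suc n])"
      by (metis (no_types, lifting) comp_apply list.map_comp map_eq_conv mset_map)
    then have "(ordered_prod n x \<^bold>\<rightarrow> u) ^ 2 \<le> prod_list (map (\<lambda>y. y ^ 2) ?ys) \<^bold>\<rightarrow> u"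
      unfolding ordered_prod_def by (intro le simple_hoop_filter.le_mod_prod_list_perm)
    then show "(ordered_prod n x \<^bold>\<rightarrow> u) ^ 2 \<le> ordered_prod n (\<lambda>i. (x (\<pi> i)) ^ 2) \<^bold>\<rightarrow> u"
      by (simp add: ordered_prod_def comp_def del: upt_Suc)
  qed
  moreover have power: "(b ^ n \<^bold>\<rightarrow> u) ^ 2 \<le> c ^ (2 * n) \<^bold>\<rightarrow> u"
    if "\<And>M. simple_hoop_filter M \<Longrightarrow> le_mod M c b" for b c n
    \<comment> \<open>Constant lists turn powers into list products; \<open>b ^ n\<close> takes the
      role of the bound in \<open>le\<close>.\<close>
    unfolding prod_list_replicate_square[symmetric]
    using that by (intro le) (auto intro: normal_hoop_filter.le_mod_power simple_hoop_filter.axioms(1))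
  have ?ii ?iii
    by (intro allI impI power simple_hoop_filter.le_mod_right_imp_left_imp
        simple_hoop_filter.le_mod_left_imp_right_imp; assumption)+
  ultimately show "?i \<and> ?ii \<and> ?iii" by blast
next
  assume *: "?i \<and> ?ii \<and> ?iii"
  have perm: "(prod_list xs \<^bold>\<rightarrow> u) ^ 2 \<le> prod_list (map (\<lambda>y. y ^ 2) ys) \<^bold>\<rightarrow> u"
    if "mset xs = mset ys" "xs \<noteq> []" for xs ys
    using ordered_prod_perm_imp_list[OF _ that] * by blast
  have "normal_filter F" if F: "maximal_filter F" for F :: "'a set"
  proof -
    have "x \<^bold>\<rightarrow> y \<in> F \<longleftrightarrow> x \<^bold>\<leadsto> y \<in> F" for x y
      using maximal_filter_transfer_mem[OF assms F perm] * by blast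
    then show ?thesis
      using F by (simp add: normal_filter_def maximal_filter_def)
  qed
  then show "in_MNPH TYPE('a)"
    by (simp add: in_MNPH_iff)
qed

end
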